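(* There are no finite groups $G$ such that $o(G)\in [2, \frac{13}{6})$. In particular, there are no finite groups $G$ such that $o(G)=2$.
   Context: For a finite group $G$ and $x\in G$, $o(x)$ denotes the order of the element $x$. The sum of element orders is $\psi(G)=\sum_{x\in G}o(x)$, and the average order of $G$ is $o(G)=\frac{\psi(G)}{|G|}$. *)

theory Defs
  imports Complex_Main "HOL-Algebra.Algebra"
begin

definition sum_element_orders :: "('a, 'b) monoid_scheme \<Rightarrow> nat" where
  "sum_element_orders G = (\<Sum>x\<in>carrier G. group.ord G x)"

definition average_order :: "('a, 'b) monoid_scheme \<Rightarrow> real" where
  "average_order G = real (sum_element_orders G) / real (order G)"

end

theory Submission
  imports Defs
begin

text \<open>
  Split \<open>G\<close> into the set \<open>I\<close> of solutions of \<open>x\<^sup>2 = 1\<close> and its complement \<open>M\<close>. The elements of \<open>I\<close>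
  contribute exactly \<open>2|I| - 1\<close> to the sum of the element orders, and every element of \<open>M\<close>
  contributes at least \<open>3\<close>. Hence an average order below \<open>13/6\<close> forces \<open>5|M| < |I| + 6\<close>.

  On the other hand, a finite group in which more than three quarters of the elements satisfy
  \<open>x\<^sup>2 = 1\<close> has exponent dividing \<open>2\<close> (lemma \<open>square_eq_one_if_three_quarters\<close>). So if \<open>M\<close> is
  nonempty, then \<open>|I| \<le> 3|M|\<close> and therefore \<open>|M| < 3\<close>. As \<open>M\<close> contains \<open>x\<close> and
  \<open>x\<^sup>-\<^sup>1 \<noteq> x\<close> together, \<open>|M| = 2\<close>, and then \<open>|G|\<close> is \<open>7\<close> or \<open>8\<close>. A group of order \<open>7\<close> has no
  involutions. In a group of order \<open>8\<close> the two elements of \<open>M\<close> have order at least \<open>4\<close>, which makes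
  the average order at least \<open>19/8 > 13/6\<close>.

  Thus an average order below \<open>13/6\<close> occurs only if \<open>M\<close> is empty, and then it equals
  \<open>(2|G| - 1)/|G| < 2\<close>.
\<close>

text \<open>The set \<open>I\<close> of all \<open>x\<close> with \<open>x\<^sup>2 = 1\<close>, that is, the involutions together with the identity.\<close>

definition square_one_set :: "('a, 'b) monoid_scheme \<Rightarrow> 'a set" where
  "square_one_set G = {x \<in> carrier G. x \<otimes>\<^bsub>G\<^esub> x = \<one>\<^bsub>G\<^esub>}"

context group
begin

lemma square_one_set_iff_ord:
  "x \<in> square_one_set G \<longleftrightarrow> x \<in> carrier G \<and> ord x dvd 2"
  using pow_eq_id[of x 2] by (auto simp: square_one_set_def numeral_2_eq_2)

lemma ord_square_one_set:
  assumes "x \<in> square_one_set G"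
  shows "ord x = (if x = \<one> then 1 else 2)"
proof -
  have x: "x \<in> carrier G" "ord x dvd 2"
    using assms by (auto simp: square_one_set_iff_ord)
  from x(2) have "ord x \<noteq> 0" "ord x \<le> 2"
    by (auto dest: dvd_imp_le intro!: Nat.gr0I)
  then have "ord x = 1 \<or> ord x = 2"
    by linarith
  then show ?thesis
    using ord_eq_1[OF x(1)] by auto
qed

lemma ord_ge_3_if_not_square_one:
  assumes "finite (carrier G)" "x \<in> carrier G" "x \<notin> square_one_set G"
  shows "ord x \<ge> 3"
proof -
  have "\<not> ord x dvd 2"
    using assms by (simp add: square_one_set_iff_ord)
  then have "ord x \<noteq> 1" "ord x \<noteq> 2"
    by auto
  moreover have "ord x \<ge> 1"
    using assms ord_ge_1 by blast
  ultimately show ?thesis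
    by linarith
qed

lemma subgroup_eq_carrier_if_more_than_half:
  assumes fin: "finite (carrier G)" and H: "subgroup H G"
    and half: "order G < 2 * card H"
  shows "H = carrier G"
proof -
  have "card (rcosets H) * card H = order G"
    using lagrange[OF H] .
  moreover have "order G > 0"
    using fin order_gt_0_iff_finite by blast
  ultimately have "card (rcosets H) * card H < 2 * card H" "card (rcosets H) \<noteq> 0"
    using half by (auto intro!: Nat.gr0I simp del: card_eq_0_iff)
  then have "card (rcosets H) = 1"
    by simp
  then have "card H = card (carrier G)"
    using \<open>card (rcosets H) * card H = order G\<close> by (simp add: order_def)
  then show ?thesis
    using card_subset_eq[OF fin subgroup.subset[OF H]] by blast
qed

lemma subgroup_centralizer_elem:
  assumes x: "x \<in> carrier G"
  shows "subgroup {y \<in> carrier G. x \<otimes> y = y \<otimes> x} G"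
proof (rule subgroupI)
  fix a assume "a \<in> {y \<in> carrier G. x \<otimes> y = y \<otimes> x}"
  then have a: "a \<in> carrier G" "x \<otimes> a = a \<otimes> x"
    by auto
  have "x \<otimes> inv a = inv a \<otimes> (a \<otimes> x) \<otimes> inv a"
    using x a(1) by (simp add: m_assoc[symmetric])
  also have "\<dots> = inv a \<otimes> (x \<otimes> a) \<otimes> inv a"
    by (simp only: a(2))
  also have "\<dots> = inv a \<otimes> x"
    using x a(1) by (simp add: m_assoc)
  finally show "inv a \<in> {y \<in> carrier G. x \<otimes> y = y \<otimes> x}"
    using a by simp
next
  fix a b
  assume "a \<in> {y \<in> carrier G. x \<otimes> y = y \<otimes> x}" "b \<in> {y \<in> carrier G. x \<otimes> y = y \<otimes> x}"
  then have ab: "a \<in> carrier G" "x \<otimes> a = a \<otimes> x" "b \<in> carrier G" "x \<otimes> b = b \<otimes> x"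
    by auto
  have "x \<otimes> (a \<otimes> b) = a \<otimes> x \<otimes> b"
    using x ab by (simp add: m_assoc[symmetric])
  also have "\<dots> = a \<otimes> b \<otimes> x"
    using x ab by (simp add: m_assoc)
  finally show "a \<otimes> b \<in> {y \<in> carrier G. x \<otimes> y = y \<otimes> x}"
    using ab by simp
qed (use x in auto)

lemma commute_if_squares_one:
  assumes "x \<in> square_one_set G" "y \<in> square_one_set G" "x \<otimes> y \<in> square_one_set G"
  shows "x \<otimes> y = y \<otimes> x"
proof -
  have inv_self: "inv z = z" if "z \<in> square_one_set G" for z
    using that inv_equality by (auto simp: square_one_set_def)
  have "x \<in> carrier G" "y \<in> carrier G"
    using assms by (auto simp: square_one_set_def)
  then show ?thesis
    using inv_mult_group[of x y] inv_self assms by simp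
qed

text \<open>
  Under the second hypothesis, for each \<open>x\<close> with \<open>x\<^sup>2 = 1\<close>, more than half of all \<open>y\<close> satisfy both \<open>y\<^sup>2 = 1\<close> and \<open>(x y)\<^sup>2 = 1\<close>, and all
  these \<open>y\<close> commute with \<open>x\<close>. So \<open>x\<close> is central, and the solutions of \<open>x\<^sup>2 = 1\<close> form a subgroup,
  which is too large to be proper.
\<close>

lemma square_eq_one_if_three_quarters:
  assumes fin: "finite (carrier G)"
    and many: "3 * order G < 4 * card (square_one_set G)"
  shows "square_one_set G = carrier G"
proof -
  let ?I = "square_one_set G"
  have I_sub: "?I \<subseteq> carrier G"
    by (auto simp: square_one_set_def)
  have fin_I: "finite ?I"
    using I_sub fin finite_subset by blast
  have central: "x \<otimes> y = y \<otimes> x" if x: "x \<in> ?I" and y: "y \<in> carrier G" for x y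
  proof -
    have xG: "x \<in> carrier G"
      using x I_sub by blast
    let ?C = "{y \<in> carrier G. x \<otimes> y = y \<otimes> x}"
    let ?J = "(\<lambda>y. x \<otimes> y) ` ?I"
    have J_sub: "?J \<subseteq> carrier G"
      using xG I_sub by auto
    have "inj_on (\<lambda>y. x \<otimes> y) ?I"
      using inj_on_cmult[OF xG] I_sub inj_on_subset by blast
    then have card_J: "card ?J = card ?I"
      by (rule card_image)
    \<comment> \<open>If \<open>y\<close> and \<open>x y\<close> are both in \<open>I\<close>, then \<open>x\<close> commutes with \<open>x y\<close> as well as with \<open>y\<close>. As \<open>I\<close> and
      \<open>x I\<close> each contain more than three quarters of \<open>G\<close>, their intersection contains more than half.\<close>
    have "?I \<inter> ?J \<subseteq> ?C"
    proof
      fix z assume "z \<in> ?I \<inter> ?J"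
      then obtain y where y: "y \<in> ?I" and z: "z = x \<otimes> y" and zI: "x \<otimes> y \<in> ?I"
        by auto
      have "x \<otimes> y = y \<otimes> x"
        using commute_if_squares_one[OF x y zI] .
      then show "z \<in> ?C"
        using z y I_sub xG m_assoc[of x y x] by auto
    qed
    then have "card (?I \<inter> ?J) \<le> card ?C"
      using fin by (intro card_mono) auto
    moreover have "card ?I + card ?J = card (?I \<union> ?J) + card (?I \<inter> ?J)"
      using fin_I by (intro card_Un_Int) auto
    moreover have "card (?I \<union> ?J) \<le> order G"
      unfolding order_def using fin I_sub J_sub by (intro card_mono) auto
    ultimately have "order G < 2 * card ?C"
      using many card_J by linarith
    then have "?C = carrier G"
      by (rule subgroup_eq_carrier_if_more_than_half[OF fin subgroup_centralizer_elem[OF xG]])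
    then show ?thesis
      using y by blast
  qed
  have "subgroup ?I G"
  proof (rule subgroupI)
    fix a assume a: "a \<in> ?I"
    then have "inv a = a"
      using inv_equality by (auto simp: square_one_set_def)
    then show "inv a \<in> ?I"
      using a by simp
  next
    fix a b assume a: "a \<in> ?I" and b: "b \<in> ?I"
    then have ab: "a \<in> carrier G" "b \<in> carrier G" "a \<otimes> a = \<one>" "b \<otimes> b = \<one>"
      by (auto simp: square_one_set_def)
    have "(a \<otimes> b) \<otimes> (a \<otimes> b) = (a \<otimes> b) \<otimes> (b \<otimes> a)"
      using central[OF a ab(2)] by simp
    also have "\<dots> = a \<otimes> (b \<otimes> b) \<otimes> a"
      using ab(1,2) by (simp add: m_assoc)
    also have "\<dots> = \<one>"
      using ab by simp
    finally show "a \<otimes> b \<in> ?I"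
      using ab by (simp add: square_one_set_def)
  qed (use I_sub in \<open>auto simp: square_one_set_def\<close>)
  then show ?thesis
    by (rule subgroup_eq_carrier_if_more_than_half[OF fin]) (use many in linarith)
qed

lemma card_not_square_one_ge_2:
  assumes fin: "finite (carrier G)" and ne: "carrier G - square_one_set G \<noteq> {}"
  shows "card (carrier G - square_one_set G) \<ge> 2"
proof -
  from ne obtain x where x: "x \<in> carrier G" "x \<notin> square_one_set G"
    by blast
  have "x \<noteq> inv x"
  proof
    assume "x = inv x"
    then have "x \<otimes> x = \<one>"
      using r_inv[OF x(1)] by simp
    then show False
      using x by (simp add: square_one_set_def)
  qed
  moreover have "inv x \<notin> square_one_set G"
    using x by (auto simp: square_one_set_iff_ord ord_inv)
  then have "{x, inv x} \<subseteq> carrier G - square_one_set G"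
    using x by auto
  then have "card {x, inv x} \<le> card (carrier G - square_one_set G)"
    using fin by (intro card_mono) auto
  ultimately show ?thesis
    by simp
qed

lemma order_eq_card_square_one_add:
  assumes fin: "finite (carrier G)"
  shows "order G = card (square_one_set G) + card (carrier G - square_one_set G)"
proof -
  have "square_one_set G \<subseteq> carrier G"
    by (auto simp: square_one_set_def)
  then show ?thesis
    using fin card_Int_Diff[OF fin, of "square_one_set G"]
    by (simp add: order_def Int_absorb1)
qed

text \<open>The summand \<open>1\<close> on the left accounts for the identity, which has order \<open>1\<close> instead of \<open>2\<close>.\<close>

lemma sum_element_orders_eq:
  assumes fin: "finite (carrier G)"
  shows "sum_element_orders G + 1 =
    2 * card (square_one_set G) + (\<Sum>x\<in>carrier G - square_one_set G. ord x)"
proof -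
  let ?I = "square_one_set G"
  have I_sub: "?I \<subseteq> carrier G"
    by (auto simp: square_one_set_def)
  have fin_I: "finite ?I"
    using I_sub fin finite_subset by blast
  have one: "\<one> \<in> ?I"
    by (simp add: square_one_set_def)
  have "(\<Sum>x\<in>?I. ord x) = (\<Sum>x\<in>?I. if x = \<one> then 1 else 2)"
    by (intro sum.cong ord_square_one_set refl)
  also have "\<dots> = 1 + (\<Sum>x\<in>?I - {\<one>}. 2)"
    by (subst sum.remove[OF fin_I one]) (simp add: sum.cong)
  also have "\<dots> + 1 = 2 * card ?I"
    using card_Suc_Diff1[OF fin_I one] by simp
  finally have "(\<Sum>x\<in>?I. ord x) + 1 = 2 * card ?I"
    by simp
  then show ?thesis
    unfolding sum_element_orders_def
    using sum.subset_diff[OF I_sub fin, of ord] by linarith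
qed

lemma sum_element_orders_ge:
  assumes fin: "finite (carrier G)"
    and k: "\<And>x. x \<in> carrier G - square_one_set G \<Longrightarrow> k \<le> ord x"
  shows "2 * card (square_one_set G) + k * card (carrier G - square_one_set G)
    \<le> sum_element_orders G + 1"
proof -
  have "card (carrier G - square_one_set G) * k \<le> (\<Sum>x\<in>carrier G - square_one_set G. ord x)"
    using sum_bounded_below[of "carrier G - square_one_set G" k ord] k by simp
  then show ?thesis
    using sum_element_orders_eq[OF fin] by (simp add: mult.commute)
qed

text \<open>The hypothesis says that the average order is below \<open>13/6\<close>.\<close>

lemma square_eq_one_if_small_sum_element_orders:
  assumes fin: "finite (carrier G)"
    and small: "6 * sum_element_orders G < 13 * order G"
  shows "square_one_set G = carrier G"
proof (rule ccontr)
  let ?I = "square_one_set G" and ?M = "carrier G - square_one_set G"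
  assume neq: "?I \<noteq> carrier G"
  have ord: "order G = card ?I + card ?M"
    by (rule order_eq_card_square_one_add[OF fin])
  have "?M \<noteq> {}"
    using neq by (auto simp: square_one_set_def)
  then have M_ge: "card ?M \<ge> 2"
    by (rule card_not_square_one_ge_2[OF fin])
  have I_le: "card ?I \<le> 3 * card ?M"
    using square_eq_one_if_three_quarters[OF fin] neq ord by linarith
  have M_ord: "ord x \<ge> 3" if "x \<in> ?M" for x
    using ord_ge_3_if_not_square_one[OF fin] that by blast
  have "2 * card ?I + 3 * card ?M \<le> sum_element_orders G + 1"
    by (rule sum_element_orders_ge[OF fin M_ord])
  then have M_lt: "5 * card ?M < card ?I + 6"
    using small ord by linarith
  then have M_eq: "card ?M = 2"
    using I_le M_ge by linarith
  then have "card ?I = 5 \<or> card ?I = 6"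
    using M_lt I_le by arith
  with M_eq consider "order G = 7" "card ?I = 5" | "order G = 8" "card ?I = 6"
    using ord by linarith
  then show False
  proof cases
    case 1
    have "\<not> ?I \<subseteq> {\<one>}"
      using 1(2) card_mono[of "{\<one>}" ?I] by auto
    then obtain x where x: "x \<in> ?I" "x \<noteq> \<one>"
      by blast
    then have "ord x = 2" "x \<in> carrier G"
      using ord_square_one_set by (auto simp: square_one_set_def)
    then have "2 dvd order G"
      using ord_dvd_group_order by metis
    then show False
      using 1(1) by simp
  next
    case 2
    have "4 \<le> ord x" if x: "x \<in> ?M" for x
    proof -
      have "ord x dvd 8"
        using ord_dvd_group_order[of x] x 2(1) by simp
      then have "ord x \<noteq> 3"
        by auto
      then show ?thesis
        using M_ord[OF x] by linarith
    qed
    then have "2 * card ?I + 4 * card ?M \<le> sum_element_orders G + 1"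
      by (rule sum_element_orders_ge[OF fin])
    then show False
      using small 2 M_eq by linarith
  qed
qed

end

theorem corollary2p5:
  fixes G :: "('a, 'b) monoid_scheme"
  assumes "group G" and "finite (carrier G)"
  shows "average_order G \<notin> {2..<13/6} \<and> average_order G \<noteq> 2"
proof -
  interpret group G
    by fact
  have pos: "real (order G) > 0"
    using assms(2) order_gt_0_iff_finite by simp
  have "average_order G < 2" if lt: "average_order G < 13/6"
  proof -
    have "6 * real (sum_element_orders G) < 13 * real (order G)"
      using lt pos by (simp add: average_order_def field_simps)
    then have "6 * sum_element_orders G < 13 * order G"
      by linarith
    then have "square_one_set G = carrier G"
      by (rule square_eq_one_if_small_sum_element_orders[OF assms(2)])
    then have "sum_element_orders G + 1 = 2 * order G"
      using sum_element_orders_eq[OF assms(2)] by (simp add: order_def)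
    then have "real (sum_element_orders G) < 2 * real (order G)"
      by linarith
    then show ?thesis
      using pos by (simp add: average_order_def field_simps)
  qed
  then show ?thesis
    by force
qed

end
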